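(* Let $R$ be an NR ring. Then $R$ is a generalized $t$-fine ring if and only if $R$ is a local ring whose group of units $\mathcal{U}(R)$ is torsion. Moreover, in this case the Jacobson radical $\mathrm{J}(R)$ is nil.
   Context: Rings are associative with identity $1$ (not necessarily commutative). For a ring $R$: $\mathrm{J}(R)$ is the Jacobson radical, $\mathrm{Nil}(R)$ the set of nilpotent elements, $\mathcal{U}(R)$ the group of units, and $\mathcal{T}(R)=\{u\in \mathcal{U}(R): u^m=1 \text{ for some } m\ge 1\}$ the set of torsion units. $R$ is generalized $t$-fine if $R\setminus \mathrm{J}(R)=\mathcal{T}(R)+\mathrm{Nil}(R)$, i.e. the elements outside the Jacobson radical are exactly the sums of a torsion unit and a nilpotent element. $R$ is an NR ring if $\mathrm{Nil}(R)$ is an (additive) subgroup of $R$. A group is torsion if each of its elements has finite order. An ideal is nil if all its elements are nilpotent. *)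

theory Defs
  imports "HOL-Algebra.Algebra"
begin

text \<open>
  Rings are those of \<^locale>\<open>ring\<close>: associative, with identity, not necessarily commutative.
  The zero ring is not excluded.
\<close>

locale left_ideal = additive_subgroup I R + ring R for I and R (structure) +
  assumes l_closed: "\<lbrakk>a \<in> I; x \<in> carrier R\<rbrakk> \<Longrightarrow> x \<otimes> a \<in> I"

locale maximal_left_ideal = left_ideal +
  assumes not_carrier: "I \<noteq> carrier R"
    and maximal: "\<lbrakk>left_ideal J R; I \<subseteq> J\<rbrakk> \<Longrightarrow> J = I \<or> J = carrier R"

text \<open>For the zero ring, which has no maximal left ideals, this is the whole ring.\<close>

definition jacobson_radical :: "('a, 'b) ring_scheme \<Rightarrow> 'a set"
  where "jacobson_radical R = {x \<in> carrier R. \<forall>I. maximal_left_ideal I R \<longrightarrow> x \<in> I}"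

definition nilpotents :: "('a, 'b) ring_scheme \<Rightarrow> 'a set"
  where "nilpotents R = {x \<in> carrier R. \<exists>n::nat. n \<ge> 1 \<and> x [^]\<^bsub>R\<^esub> n = \<zero>\<^bsub>R\<^esub>}"

definition torsion_units :: "('a, 'b) ring_scheme \<Rightarrow> 'a set"
  where "torsion_units R = {u \<in> Units R. \<exists>m::nat. m \<ge> 1 \<and> u [^]\<^bsub>R\<^esub> m = \<one>\<^bsub>R\<^esub>}"

locale torsion_group = group +
  assumes finite_order: "x \<in> carrier G \<Longrightarrow> \<exists>m::nat. m \<ge> 1 \<and> x [^] m = \<one>"

locale nil_ideal = ideal +
  assumes nil: "I \<subseteq> nilpotents R"

locale nr_ring = ring +
  assumes nilpotents_additive_subgroup: "additive_subgroup (nilpotents R) R"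

locale generalized_t_fine_ring = ring +
  assumes t_fine: "carrier R - jacobson_radical R = torsion_units R <+> nilpotents R"

text \<open>The zero ring is not local, since it has no maximal left ideal.\<close>

locale local_ring = ring +
  assumes unique_maximal_left_ideal: "\<exists>!I. maximal_left_ideal I R"

end

theory Submission
  imports Defs
begin

text \<open>
  If the nilpotents form an additive group, a nilpotent outside the radical, decomposed as a torsion
  unit plus a nilpotent, would make that unit nilpotent. So the radical contains all nilpotents and,
  absorbing them into the unit summand, everything outside the
  radical is a unit, and the ring is local. Decomposing an integer outside the radical shows that the
  characteristic is positive, so the subring generated by a torsion unit or by a nilpotent element
  is finite. For \<open>j\<close> in the radical write \<open>1 + j = t + q\<close>: some power of \<open>t - 1\<close>
  repeats, so \<open>t - 1\<close>, being in the radical, is nilpotent, and therefore so is \<open>j = (t - 1) + q\<close>.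
  Every unit has a power of the form \<open>1 + j\<close>, whose powers also repeat.
\<close>

section \<open>Left ideals and the Jacobson radical\<close>

context ring
begin

text \<open>Closure under negation comes for free, since the negative of \<open>a\<close> is the
  left multiple of \<open>a\<close> by minus one.\<close>

lemma left_idealI:
  assumes "I \<subseteq> carrier R" "\<zero> \<in> I"
    and "\<And>a b. \<lbrakk>a \<in> I; b \<in> I\<rbrakk> \<Longrightarrow> a \<oplus> b \<in> I"
    and l: "\<And>a x. \<lbrakk>a \<in> I; x \<in> carrier R\<rbrakk> \<Longrightarrow> x \<otimes> a \<in> I"
  shows "left_ideal I R"
proof -
  have neg: "\<ominus> a \<in> I" if "a \<in> I" for a
    using l[OF that, of "\<ominus> \<one>"] subsetD[OF assms(1) that] by (simp add: l_minus)
  have "subgroup I (add_monoid R)"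
    using assms neg by (intro add.subgroupI) blast+
  then show ?thesis
    using l by (intro left_ideal.intro additive_subgroupI left_ideal_axioms.intro ring_axioms)
qed

lemma left_idealD:
  assumes "left_ideal I R"
  shows "I \<subseteq> carrier R" "\<zero> \<in> I"
    and "\<And>a b. \<lbrakk>a \<in> I; b \<in> I\<rbrakk> \<Longrightarrow> a \<oplus> b \<in> I"
    and "\<And>a. a \<in> I \<Longrightarrow> \<ominus> a \<in> I"
    and "\<And>a x. \<lbrakk>a \<in> I; x \<in> carrier R\<rbrakk> \<Longrightarrow> x \<otimes> a \<in> I"
proof -
  interpret left_ideal I R by fact
  show "I \<subseteq> carrier R" "\<zero> \<in> I"
    and "\<And>a b. \<lbrakk>a \<in> I; b \<in> I\<rbrakk> \<Longrightarrow> a \<oplus> b \<in> I"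
    and "\<And>a. a \<in> I \<Longrightarrow> \<ominus> a \<in> I"
    and "\<And>a x. \<lbrakk>a \<in> I; x \<in> carrier R\<rbrakk> \<Longrightarrow> x \<otimes> a \<in> I"
    using a_subset l_closed by auto
qed

lemma left_ideal_eq_carrier:
  assumes "left_ideal I R" "y \<in> carrier R" "x \<in> I" "y \<otimes> x = \<one>"
  shows "I = carrier R"
proof -
  have "\<one> \<in> I" using left_idealD(5)[OF assms(1,3,2)] assms(4) by simp
  then show ?thesis
    using left_idealD(1)[OF assms(1)] left_idealD(5)[OF assms(1), of \<one>] by auto
qed

lemma maximal_left_idealD:
  assumes "maximal_left_ideal M R"
  shows "left_ideal M R" "\<one> \<notin> M"
proof -
  interpret maximal_left_ideal M R by fact
  show "left_ideal M R" by (rule left_ideal_axioms)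
  then show "\<one> \<notin> M" using left_ideal_eq_carrier[of M \<one> \<one>] not_carrier by auto
qed

lemma exists_maximal_left_ideal:
  assumes "left_ideal I R" "\<one> \<notin> I"
  obtains M where "maximal_left_ideal M R" "I \<subseteq> M"
proof -
  \<comment> \<open>Properness is expressed by omitting \<open>\<one>\<close>, a condition that
    visibly survives unions of chains.\<close>
  define A where "A = {J. left_ideal J R \<and> I \<subseteq> J \<and> \<one> \<notin> J}"
  have "\<exists>M\<in>A. \<forall>K\<in>A. M \<subseteq> K \<longrightarrow> K = M"
  proof (rule subset_Zorn_nonempty)
    show "A \<noteq> {}" using assms by (auto simp: A_def)
    fix C assume C: "C \<noteq> {}" and ch: "subset.chain A C"
    then have AJ: "J \<in> A" if "J \<in> C" for J
      using that by (auto simp: subset_chain_def)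
    obtain J\<^sub>0 where J\<^sub>0: "J\<^sub>0 \<in> C" using C by auto
    have "left_ideal (\<Union>C) R"
    proof (rule left_idealI)
      show "\<Union>C \<subseteq> carrier R" using AJ left_idealD(1) unfolding A_def by blast
      show "\<zero> \<in> \<Union>C" using AJ[OF J\<^sub>0] J\<^sub>0 left_idealD(2) unfolding A_def by blast
      show "x \<otimes> a \<in> \<Union>C" if "a \<in> \<Union>C" "x \<in> carrier R" for a x
        using that AJ left_idealD(5) unfolding A_def by blast
      fix a b assume "a \<in> \<Union>C" "b \<in> \<Union>C"
      then obtain J K where JK: "J \<in> C" "a \<in> J" "K \<in> C" "b \<in> K" by auto
      then have "J \<subseteq> K \<or> K \<subseteq> J" using ch by (auto simp: subset_chain_def)
      then have "\<exists>L\<in>C. a \<in> L \<and> b \<in> L" using JK by blast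
      then show "a \<oplus> b \<in> \<Union>C" using AJ left_idealD(3) unfolding A_def by blast
    qed
    then show "\<Union>C \<in> A" using AJ J\<^sub>0 unfolding A_def by blast
  qed
  then obtain M where "M \<in> A" and max: "\<And>K. \<lbrakk>K \<in> A; M \<subseteq> K\<rbrakk> \<Longrightarrow> K = M" by blast
  then have M: "left_ideal M R" "I \<subseteq> M" "\<one> \<notin> M" by (auto simp: A_def)
  have "maximal_left_ideal M R"
  proof (intro maximal_left_ideal.intro maximal_left_ideal_axioms.intro M(1))
    show "M \<noteq> carrier R" using M(3) by auto
    show "J = M \<or> J = carrier R" if "left_ideal J R" "M \<subseteq> J" for J
      using left_ideal_eq_carrier[OF that(1), of \<one> \<one>] max[of J] that M(2) by (auto simp: A_def)
  qed
  then show thesis using M(2) that by blast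
qed

text \<open>If the principal left ideal of \<open>x\<close> omitted \<open>\<one>\<close>, it would
  lie in a maximal left ideal, which would then contain \<open>x\<close>.\<close>

lemma left_inverse_if_notin_maximal:
  assumes x: "x \<in> carrier R" and "\<And>M. maximal_left_ideal M R \<Longrightarrow> x \<notin> M"
  obtains y where "y \<in> carrier R" "y \<otimes> x = \<one>"
proof -
  let ?I = "(\<lambda>y. y \<otimes> x) ` carrier R"
  have "left_ideal ?I R"
  proof (rule left_idealI)
    show "\<zero> \<in> ?I" using x by (intro image_eqI[of _ _ \<zero>]) auto
    show "a \<oplus> b \<in> ?I" if ab: "a \<in> ?I" "b \<in> ?I" for a b
    proof -
      obtain y z where "a = y \<otimes> x" "b = z \<otimes> x" "y \<in> carrier R" "z \<in> carrier R"
        using ab by auto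
      then show ?thesis using x by (intro image_eqI[of _ _ "y \<oplus> z"]) (auto simp: l_distr)
    qed
    show "r \<otimes> a \<in> ?I" if ar: "a \<in> ?I" "r \<in> carrier R" for a r
    proof -
      obtain y where "a = y \<otimes> x" "y \<in> carrier R" using ar by auto
      then show ?thesis using x ar by (intro image_eqI[of _ _ "r \<otimes> y"]) (auto simp: m_assoc)
    qed
  qed (use x in auto)
  moreover have "x \<in> ?I" using x by (intro image_eqI[of _ _ \<one>]) auto
  ultimately have "\<one> \<in> ?I" using assms(2) exists_maximal_left_ideal by (metis subsetD)
  then show thesis using that by auto
qed

lemma jacobson_radical_subset_maximal:
  assumes "maximal_left_ideal M R"
  shows "jacobson_radical R \<subseteq> M"
  using assms unfolding jacobson_radical_def by blast

lemma left_ideal_jacobson_radical: "left_ideal (jacobson_radical R) R"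
proof -
  have M: "left_ideal M R" if "maximal_left_ideal M R" for M
    using maximal_left_idealD(1)[OF that] .
  show ?thesis
    by (rule left_idealI) (auto simp: jacobson_radical_def left_idealD(2,3,5)[OF M])
qed

lemmas jacobson_radical_closed = left_idealD[OF left_ideal_jacobson_radical]

text \<open>Nontriviality makes the zero ideal proper, so some maximal left ideal exists. In the
  zero ring the radical is everything.\<close>

lemma one_notin_jacobson_radical:
  assumes "\<one> \<noteq> \<zero>"
  shows "\<one> \<notin> jacobson_radical R"
proof -
  have "left_ideal {\<zero>} R" by (rule left_idealI) auto
  then obtain M where "maximal_left_ideal M R"
    using exists_maximal_left_ideal assms by blast
  then show ?thesis using maximal_left_idealD(2) by (auto simp: jacobson_radical_def)
qed

lemma one_plus_jacobson_radical_left_inverse: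
  assumes "j \<in> jacobson_radical R"
  obtains y where "y \<in> carrier R" "y \<otimes> (\<one> \<oplus> j) = \<one>"
proof -
  have j: "j \<in> carrier R" using assms jacobson_radical_closed(1) by auto
  have "\<one> \<oplus> j \<notin> M" if M: "maximal_left_ideal M R" for M
  proof
    assume m: "\<one> \<oplus> j \<in> M"
    note MI = maximal_left_idealD[OF M]
    have "j \<in> M" using assms M by (auto simp: jacobson_radical_def)
    then have "(\<one> \<oplus> j) \<oplus> \<ominus> j \<in> M" using m left_idealD[OF MI(1)] by blast
    then show False using MI(2) j by (simp add: a_assoc r_neg)
  qed
  then show thesis using left_inverse_if_notin_maximal[of "\<one> \<oplus> j"] j that by auto
qed

lemma UnitsI:
  assumes "x \<in> carrier R" "y \<in> carrier R" "y \<otimes> x = \<one>" "x \<otimes> y = \<one>"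
  shows "x \<in> Units R"
  using assms by (auto simp: Units_def)

text \<open>A left inverse \<open>y\<close> of \<open>1 + j\<close> satisfies
  \<open>y = 1 - y j\<close>, so it again has the form one plus a radical element and has a left
  inverse itself. An element with both a left inverse and a right inverse is a unit, so
  \<open>y\<close> and \<open>1 + j\<close> are mutually inverse.\<close>

lemma one_plus_jacobson_radical_Units:
  assumes j: "j \<in> jacobson_radical R"
  shows "\<one> \<oplus> j \<in> Units R"
proof -
  have jc: "j \<in> carrier R" using j jacobson_radical_closed(1) by auto
  obtain y where y: "y \<in> carrier R" "y \<otimes> (\<one> \<oplus> j) = \<one>"
    using one_plus_jacobson_radical_left_inverse[OF j] .
  have k: "\<ominus> (y \<otimes> j) \<in> jacobson_radical R"
    using jacobson_radical_closed(4,5) j y by blast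
  have "y \<oplus> y \<otimes> j = \<one>" using y jc by (simp add: r_distr)
  then have "y = \<one> \<oplus> \<ominus> (y \<otimes> j)" using y jc
    by (metis a_assoc a_inv_closed m_closed r_neg r_zero)
  then obtain z where z: "z \<in> carrier R" "z \<otimes> y = \<one>"
    using one_plus_jacobson_radical_left_inverse[OF k] by auto
  have "z = \<one> \<oplus> j" using inv_unique[of z y "\<one> \<oplus> j"] y z jc by auto
  then show ?thesis using UnitsI[of "\<one> \<oplus> j" y] y z jc by auto
qed

text \<open>Factor \<open>u + j\<close> as \<open>u (1 + u^-1 j)\<close>; closure of the radical
  under left multiplication suffices for this.\<close>

lemma Units_plus_jacobson_radical:
  assumes u: "u \<in> Units R" and j: "j \<in> jacobson_radical R"
  shows "u \<oplus> j \<in> Units R"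
proof -
  have jc: "j \<in> carrier R" using j jacobson_radical_closed(1) by auto
  have "\<one> \<oplus> inv u \<otimes> j \<in> Units R"
    using one_plus_jacobson_radical_Units jacobson_radical_closed(5) u j by auto
  then have "u \<otimes> (\<one> \<oplus> inv u \<otimes> j) \<in> Units R" using u by blast
  moreover have "u \<otimes> (\<one> \<oplus> inv u \<otimes> j) = u \<oplus> j"
    using u jc by (simp add: r_distr Units_closed m_assoc[symmetric])
  ultimately show ?thesis by simp
qed

lemma Units_notin_jacobson_radical:
  assumes "\<one> \<noteq> \<zero>" "u \<in> Units R"
  shows "u \<notin> jacobson_radical R"
  using assms one_notin_jacobson_radical jacobson_radical_closed(5)[of u "inv u"] by auto

lemma set_addI: "\<lbrakk>x \<in> A; y \<in> B\<rbrakk> \<Longrightarrow> x \<oplus> y \<in> A <+> B"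
  unfolding set_add_def' by blast

lemma nilpotentsE:
  assumes "x \<in> nilpotents R"
  obtains n :: nat where "x \<in> carrier R" "n \<ge> 1" "x [^] n = \<zero>"
  using assms by (auto simp: nilpotents_def)

lemma Units_pow: "u \<in> Units R \<Longrightarrow> u [^] (n::nat) \<in> Units R"
  by (induction n) auto

lemma Units_not_nilpotent:
  assumes "\<one> \<noteq> \<zero>" "u \<in> Units R"
  shows "u \<notin> nilpotents R"
proof
  assume "u \<in> nilpotents R"
  then obtain n :: nat where "u [^] n = \<zero>" by (rule nilpotentsE)
  then have "\<zero> \<in> Units R" using Units_pow[OF assms(2)] by metis
  then show False using assms(1) by (metis Units_inv_closed Units_r_inv l_null)
qed

end

section \<open>Finiteness\<close>

text \<open>Adding one generator \<open>g\<close> enlarges the group at most to its product with the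
  finite cyclic group of \<open>g\<close>, which is a subgroup by commutativity. It is applied to
  the additive group of a ring of positive characteristic.\<close>

lemma (in comm_group) finite_generate_if_pow_eq_one:
  assumes "finite S" "S \<subseteq> carrier G" "(N::nat) \<noteq> 0" "\<And>x. x \<in> S \<Longrightarrow> x [^] N = \<one>"
  shows "finite (generate G S)"
  using assms(1,2,4)
proof (induction S)
  case empty
  then show ?case by (simp add: generate_empty)
next
  case (insert g S)
  have g: "g \<in> carrier G" and S: "S \<subseteq> carrier G" using insert.prems by auto
  have "finite (carrier (subgroup_generated G {g}))"
    using finite_cyclic_subgroup[OF g] insert.prems(2)[of g] assms(3) by auto
  then have fin: "finite (generate G {g})"
    using g by (simp add: carrier_subgroup_generated)
  have sub: "subgroup (generate G S <#> generate G {g}) G"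
    using mult_subgroups generate_is_subgroup S g by auto
  have mem: "a \<otimes> b \<in> generate G S <#> generate G {g}"
    if "a \<in> generate G S" "b \<in> generate G {g}" for a b
    using that by (auto simp: set_mult_def)
  have "x \<in> generate G S <#> generate G {g}" if x: "x \<in> insert g S" for x
  proof -
    have "x \<in> carrier G" using x g S by auto
    then show ?thesis
      using x mem[OF generate.one generate.incl, of g] mem[OF generate.incl generate.one, of x]
      by auto
  qed
  then have "generate G (insert g S) \<subseteq> generate G S <#> generate G {g}"
    by (intro generate_subgroup_incl sub) auto
  moreover have "finite (generate G S <#> generate G {g})"
    unfolding set_mult_def using insert.IH insert.prems S fin by auto
  ultimately show ?case by (rule finite_subset)
qed

context ring
begin

lemma add_pow_eq_zero:
  assumes "x \<in> carrier R" "[(N::nat)] \<cdot> \<one> = \<zero>"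
  shows "[N] \<cdot> x = \<zero>"
  using add_pow_ldistr[of \<one> x N] assms by simp

text \<open>The additive group \<open>F\<close> generated by the powers of \<open>y\<close> is
  finite, because it has finitely many generators and bounded exponent. It is stable under left
  multiplication by \<open>y\<close> and by \<open>c\<close>, hence by \<open>y + c\<close>, and so
  contains all powers of \<open>y + c\<close>. The two values of \<open>c\<close> serve to pass from
  \<open>t\<close> to \<open>t - 1\<close> and from \<open>j\<close> to
  \<open>j + 1\<close>.\<close>

lemma finite_range_pow_plus:
  assumes y: "y \<in> carrier R" and fin: "finite (range (\<lambda>n::nat. y [^] n))"
    and N: "(N::nat) \<noteq> 0" "[N] \<cdot> \<one> = \<zero>" and c: "c = \<one> \<or> c = \<ominus> \<one>"
  shows "finite (range (\<lambda>n::nat. (y \<oplus> c) [^] n))"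
proof -
  let ?S = "range (\<lambda>n::nat. y [^] n)"
  define F where "F = generate (add_monoid R) ?S"
  have S: "?S \<subseteq> carrier R" using y by auto
  have sub: "subgroup F (add_monoid R)"
    unfolding F_def using S by (intro add.generate_is_subgroup) auto
  then interpret F: additive_subgroup F R by (rule additive_subgroupI)
  have finF: "finite F"
    unfolding F_def
    using add.finite_generate_if_pow_eq_one[OF fin S N(1)] add_pow_eq_zero[OF _ N(2)] S by auto
  \<comment> \<open>Stability of \<open>F\<close> under \<open>y\<close> is reduced to generators:
    the preimage of \<open>F\<close> under left multiplication by \<open>y\<close> is an additive
    subgroup containing every power of \<open>y\<close>.\<close>
  let ?H = "{x \<in> carrier R. y \<otimes> x \<in> F}"
  have "subgroup ?H (add_monoid R)"
    using y by (intro add.subgroupI) (auto simp: r_distr r_minus)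
  moreover have "y \<otimes> y [^] n \<in> F" for n :: nat
    unfolding F_def using y by (intro generate.incl) (metis nat_pow_Suc2 rangeI)
  then have "?S \<subseteq> ?H" using y by auto
  ultimately have "F \<subseteq> ?H"
    unfolding F_def by (intro add.generate_subgroup_incl)
  then have yF: "y \<otimes> x \<in> F" "x \<in> carrier R" if "x \<in> F" for x using that by blast+
  have mult: "(y \<oplus> c) \<otimes> x \<in> F" if x: "x \<in> F" for x
  proof -
    have "(y \<oplus> c) \<otimes> x = y \<otimes> x \<oplus> c \<otimes> x" using y c yF(2)[OF x] by (auto simp: l_distr)
    moreover have "c \<otimes> x \<in> F" using c x yF(2)[OF x] by (auto simp: l_minus)
    ultimately show ?thesis using yF(1)[OF x] by simp
  qed
  have "y [^] (0::nat) \<in> F" unfolding F_def by (rule generate.incl) blast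
  then have "(y \<oplus> c) [^] n \<in> F" for n :: nat
  proof (induction n)
    case (Suc n)
    have "y \<oplus> c \<in> carrier R" using y c by auto
    then show ?case using mult Suc nat_pow_Suc2[of "y \<oplus> c" n] by simp
  qed simp
  then show ?thesis using finite_subset[OF _ finF] by (simp add: image_subset_iff)
qed

lemma pow_repeats:
  assumes "x \<in> carrier R" "finite (range (\<lambda>n::nat. x [^] n))"
  obtains i d :: nat where "d \<ge> 1" "x [^] i = x [^] i \<otimes> x [^] d"
proof -
  have "\<not> inj (\<lambda>n::nat. x [^] n)" using assms(2) finite_imageD by blast
  then obtain i j :: nat where ij: "x [^] i = x [^] j" "i < j"
    unfolding inj_def by (metis linorder_neqE_nat)
  then have "x [^] i = x [^] i \<otimes> x [^] (j - i)"
    using assms(1) nat_pow_mult[of x i "j - i"] by simp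
  then show thesis using that[of "j - i" i] ij by auto
qed

lemma Units_torsion_if_finite_range_pow:
  assumes u: "u \<in> Units R" and fin: "finite (range (\<lambda>n::nat. u [^] n))"
  shows "u \<in> torsion_units R"
proof -
  obtain i d :: nat where d: "d \<ge> 1" "u [^] i = u [^] i \<otimes> u [^] d"
    using pow_repeats[OF Units_closed[OF u] fin] .
  have "u [^] i \<otimes> \<one> = u [^] i \<otimes> u [^] d" using d u by (simp add: Units_closed)
  then have "u [^] d = \<one>"
    using Units_l_cancel[OF Units_pow[OF u, of i], of \<one> "u [^] d"] u by (auto simp: Units_closed)
  then show ?thesis using u d by (auto simp: torsion_units_def)
qed

text \<open>A repetition among the powers gives \<open>j^i (1 - j^d) = 0\<close>. The second factor
  is a unit because \<open>j^d\<close> lies in the radical, so \<open>j^i = 0\<close>.\<close>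

lemma jacobson_radical_nilpotent_if_finite_range_pow:
  assumes j: "j \<in> jacobson_radical R" and fin: "finite (range (\<lambda>n::nat. j [^] n))"
  shows "j \<in> nilpotents R"
proof -
  have jc: "j \<in> carrier R" using j jacobson_radical_closed(1) by auto
  obtain i d :: nat where d: "d \<ge> 1" "j [^] i = j [^] i \<otimes> j [^] d"
    using pow_repeats[OF jc fin] .
  let ?v = "\<one> \<oplus> \<ominus> (j [^] d)"
  have "j [^] d \<in> jacobson_radical R"
    using jacobson_radical_closed(5)[OF j, of "j [^] (d - 1)"] jc d(1) nat_pow_Suc[of j "d - 1"] by auto
  then have v: "?v \<in> Units R"
    using one_plus_jacobson_radical_Units jacobson_radical_closed(4) by blast
  have "j [^] i \<otimes> ?v = j [^] i \<oplus> \<ominus> (j [^] i \<otimes> j [^] d)"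
    using jc by (simp add: r_distr r_minus)
  also have "\<dots> = j [^] i \<oplus> \<ominus> (j [^] i)" using d(2) by metis
  finally have "j [^] i \<otimes> ?v = \<zero>" using jc by (simp add: r_neg)
  then have "j [^] i \<otimes> ?v \<otimes> inv ?v = \<zero>" using v by auto
  then have "j [^] i = \<zero>" using v jc m_assoc[of "j [^] i" ?v "inv ?v"] by auto
  \<comment> \<open>The repetition may start at \<open>i = 0\<close>, whereas nilpotency asks for a
    positive exponent.\<close>
  then have "j [^] Suc i = \<zero>" using jc by simp
  then show ?thesis using jc unfolding nilpotents_def by (auto intro!: exI[of _ "Suc i"])
qed

lemma finite_range_pow_if_pow_eq_one:
  assumes t: "t \<in> carrier R" "t [^] (m::nat) = \<one>" "m \<ge> 1"
  shows "finite (range (\<lambda>n::nat. t [^] n))"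
proof -
  have "t [^] n = t [^] (n mod m)" for n
  proof -
    have "t [^] n = t [^] (m * (n div m) + n mod m)" by simp
    also have "\<dots> = (t [^] m) [^] (n div m) \<otimes> t [^] (n mod m)"
      using t(1) by (simp only: nat_pow_mult nat_pow_pow)
    finally show ?thesis using t by simp
  qed
  then have "range (\<lambda>n::nat. t [^] n) \<subseteq> (\<lambda>n. t [^] n) ` {..<m}" using t(3)
    by (metis (no_types, lifting) image_eqI image_subsetI lessThan_iff less_le_trans mod_less_divisor zero_less_one)
  then show ?thesis by (rule finite_subset) auto
qed

lemma finite_range_pow_if_nilpotent:
  assumes "x \<in> nilpotents R"
  shows "finite (range (\<lambda>n::nat. x [^] n))"
proof -
  obtain k :: nat where k: "x \<in> carrier R" "x [^] k = \<zero>" using assms by (rule nilpotentsE)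
  have "x [^] n = \<zero>" if "n \<ge> k" for n
    using nat_pow_mult[of x k "n - k"] k that by simp
  then have "range (\<lambda>n::nat. x [^] n) \<subseteq> insert \<zero> ((\<lambda>n. x [^] n) ` {..<k})"
    by (auto simp: not_less) (metis imageI lessThan_iff not_less)
  then show ?thesis by (rule finite_subset) auto
qed

section \<open>Characteristic\<close>

text \<open>A binomial expansion modulo \<open>q\<close>. The cofactor \<open>s\<close> is made to
  commute with \<open>q\<close> so that \<open>q s\<close> inherits nilpotency from
  \<open>q\<close>.\<close>

lemma pow_plus_commuting:
  assumes "t \<in> carrier R" "q \<in> carrier R" "t \<otimes> q = q \<otimes> t"
  obtains s where "s \<in> carrier R" "s \<otimes> q = q \<otimes> s"
    "(t \<oplus> q) [^] (m::nat) = t [^] m \<oplus> q \<otimes> s"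
proof -
  have "\<exists>s\<in>carrier R. s \<otimes> q = q \<otimes> s \<and> (t \<oplus> q) [^] m = t [^] m \<oplus> q \<otimes> s"
  proof (induction m)
    case 0
    then show ?case using assms by (intro bexI[of _ \<zero>]) auto
  next
    case (Suc m)
    then obtain s where s: "s \<in> carrier R" "s \<otimes> q = q \<otimes> s"
      and e: "(t \<oplus> q) [^] m = t [^] m \<oplus> q \<otimes> s" by auto
    have c: "t [^] m \<otimes> q = q \<otimes> t [^] m" using assms group_commutes_pow by auto
    \<comment> \<open>Read off from
      \<open>(t^m + q s)(t + q) = t^(m+1) + q (t^m + s (t + q))\<close>.\<close>
    let ?s = "t [^] m \<oplus> s \<otimes> (t \<oplus> q)"
    have "s \<otimes> (q \<otimes> x) = q \<otimes> (s \<otimes> x)" if "x \<in> carrier R" for x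
      using s assms that by (simp flip: m_assoc)
    then have "?s \<otimes> q = q \<otimes> ?s"
      using s assms c by (simp add: l_distr r_distr m_assoc)
    moreover have "(t \<oplus> q) [^] Suc m = t [^] Suc m \<oplus> q \<otimes> ?s"
      using s assms c e by (simp add: l_distr r_distr m_assoc a_ac)
    ultimately show ?case using s assms by (intro bexI[of _ ?s]) auto
  qed
  then show thesis using that by blast
qed

lemma add_pow_one_mult: "([(a::nat)] \<cdot> \<one>) \<otimes> ([(b::nat)] \<cdot> \<one>) = [(a * b)] \<cdot> \<one>"
  by (simp add: add_pow_ldistr add.nat_pow_pow mult.commute)

lemma add_pow_one_pow: "([(a::nat)] \<cdot> \<one>) [^] (n::nat) = [(a ^ n)] \<cdot> \<one>"
  by (induction n) (simp_all add: add_pow_one_mult mult.commute)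

lemma add_pow_one_commute:
  assumes "x \<in> carrier R"
  shows "([(a::nat)] \<cdot> \<one>) \<otimes> x = x \<otimes> ([a] \<cdot> \<one>)"
  using assms by (simp add: add_pow_ldistr add_pow_rdistr)

text \<open>Multiples of \<open>\<one>\<close> are central, so \<open>t\<close> and \<open>q\<close>
  commute. With \<open>t^m = 1\<close> the expansion gives \<open>a^m = 1 + q s\<close> in the ring,
  so the integer \<open>a^m - 1\<close> is nilpotent there and a power of it is zero. The bound on
  \<open>a\<close> makes that integer nonzero.\<close>

lemma positive_characteristic_if_torsion_plus_nilpotent:
  assumes t: "t \<in> torsion_units R" and q: "q \<in> nilpotents R"
    and a: "[(a::nat)] \<cdot> \<one> = t \<oplus> q" "a \<ge> 2"
  obtains N :: nat where "N \<noteq> 0" "[N] \<cdot> \<one> = \<zero>"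
proof -
  obtain m :: nat where m: "m \<ge> 1" "t [^] m = \<one>" and tc: "t \<in> carrier R"
    using t by (auto simp: torsion_units_def)
  obtain k :: nat where k: "q \<in> carrier R" "q [^] k = \<zero>" using q by (rule nilpotentsE)
  have "(t \<oplus> q) \<otimes> q = q \<otimes> (t \<oplus> q)"
    using add_pow_one_commute[of q a] k a by simp
  then have "t \<otimes> q = q \<otimes> t" using tc k(1)
    by (simp add: l_distr r_distr)
  then obtain s where s: "s \<in> carrier R" "s \<otimes> q = q \<otimes> s"
    and e: "(t \<oplus> q) [^] m = t [^] m \<oplus> q \<otimes> s"
    using pow_plus_commuting tc k(1) by metis
  have "a ^ m \<ge> 2" using m a(2) by (metis le_trans self_le_power one_le_numeral less_le_trans zero_less_one)
  define M where "M = a ^ m - 1"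
  have M: "a ^ m = Suc M" "M \<noteq> 0" using \<open>a ^ m \<ge> 2\<close> by (auto simp: M_def)
  have "([M] \<cdot> \<one>) \<oplus> \<one> = q \<otimes> s \<oplus> \<one>"
    using e m a add_pow_one_pow[of a m] M s k a_comm by simp
  then have "[M] \<cdot> \<one> = q \<otimes> s" using s k by simp
  moreover have "(q \<otimes> s) [^] k = \<zero>" using pow_mult_distrib[of q s k] s k by simp
  ultimately have "[(M ^ k)] \<cdot> \<one> = \<zero>" using add_pow_one_pow[of M k] by simp
  then show thesis using that[of "M ^ k"] M by simp
qed

section \<open>Local rings\<close>

text \<open>Otherwise \<open>x r\<close> is a unit and \<open>x\<close> has a right inverse
  \<open>y\<close>. Then \<open>1 - y x\<close> is a unit, yet
  \<open>(1 - y x) y = y - y (x y) = 0\<close>, so \<open>y = 0\<close>, contradicting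
  \<open>x y = 1\<close>.\<close>

lemma jacobson_radical_right_closed:
  assumes "\<one> \<noteq> \<zero>" and Un: "carrier R - jacobson_radical R \<subseteq> Units R"
    and x: "x \<in> jacobson_radical R" and r: "r \<in> carrier R"
  shows "x \<otimes> r \<in> jacobson_radical R"
proof (rule ccontr)
  have xc: "x \<in> carrier R" using x jacobson_radical_closed(1) by auto
  assume "x \<otimes> r \<notin> jacobson_radical R"
  then have u: "x \<otimes> r \<in> Units R" using Un xc r by auto
  define y where "y = r \<otimes> inv (x \<otimes> r)"
  have y: "y \<in> carrier R" "x \<otimes> y = \<one>"
    using u xc r by (auto simp: y_def m_assoc[symmetric])
  have "\<ominus> (y \<otimes> x) \<in> jacobson_radical R" using jacobson_radical_closed(4,5) x y by blast
  then have v: "\<one> \<oplus> \<ominus> (y \<otimes> x) \<in> Units R" by (rule one_plus_jacobson_radical_Units)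
  have "(\<one> \<oplus> \<ominus> (y \<otimes> x)) \<otimes> y = \<zero>"
    using xc y by (simp add: l_distr l_minus m_assoc r_neg)
  then have "y = \<zero>"
    using Units_l_cancel[OF v y(1) zero_closed] v by (simp add: Units_closed)
  then show False using y xc assms(1) by simp
qed

text \<open>A proper left ideal contains no unit, hence nothing outside the radical.\<close>

lemma maximal_left_ideal_jacobson_radical:
  assumes "\<one> \<noteq> \<zero>" and Un: "carrier R - jacobson_radical R \<subseteq> Units R"
  shows "maximal_left_ideal (jacobson_radical R) R"
proof (intro maximal_left_ideal.intro maximal_left_ideal_axioms.intro left_ideal_jacobson_radical)
  show "jacobson_radical R \<noteq> carrier R" using one_notin_jacobson_radical[OF assms(1)] by auto
  show "J = jacobson_radical R \<or> J = carrier R"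
    if J: "left_ideal J R" "jacobson_radical R \<subseteq> J" for J
  proof (rule disjCI)
    assume "J \<noteq> carrier R"
    then have "x \<notin> J" if "x \<in> Units R" for x
      using left_ideal_eq_carrier[OF J(1), of "inv x" x] that by auto
    then show "J = jacobson_radical R" using J left_idealD(1)[OF J(1)] Un by blast
  qed
qed

text \<open>The radical is itself maximal and lies in every maximal left ideal, so it is the only
  one.\<close>

lemma local_ring_if_Units:
  assumes "\<one> \<noteq> \<zero>" and "carrier R - jacobson_radical R \<subseteq> Units R"
  shows "local_ring R"
proof (intro local_ring.intro local_ring_axioms.intro ring_axioms ex1I)
  note J = maximal_left_ideal_jacobson_radical[OF assms]
  then show "maximal_left_ideal (jacobson_radical R) R" .
  fix M assume M: "maximal_left_ideal M R"
  interpret J: maximal_left_ideal "jacobson_radical R" R by fact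
  have "M = jacobson_radical R \<or> M = carrier R"
    using J.maximal maximal_left_idealD(1)[OF M] jacobson_radical_subset_maximal[OF M] by metis
  then show "M = jacobson_radical R" using maximal_left_idealD(2)[OF M] one_closed by metis
qed

end

section \<open>Local rings with torsion units are generalized t-fine\<close>

context local_ring
begin

lemma maximal_left_ideal_eq_jacobson_radical:
  assumes "maximal_left_ideal M R"
  shows "M = jacobson_radical R"
proof
  have "I = M" if "maximal_left_ideal I R" for I
    using assms that unique_maximal_left_ideal by metis
  then show "M \<subseteq> jacobson_radical R"
    using left_idealD(1)[OF maximal_left_idealD(1)[OF assms]]
    unfolding jacobson_radical_def by blast
qed (rule jacobson_radical_subset_maximal[OF assms])

lemma one_not_zero: "\<one> \<noteq> \<zero>"
proof -
  obtain M where "maximal_left_ideal M R" using unique_maximal_left_ideal by blast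
  then have "left_ideal M R" "\<one> \<notin> M" by (rule maximal_left_idealD)+
  then show ?thesis using left_idealD(2) by metis
qed

text \<open>Outside the only maximal left ideal, left inverses exist. A left inverse
  \<open>y\<close> of \<open>x\<close> also lies outside: otherwise \<open>1 - x y\<close> would be
  a unit killing \<open>x\<close>. So \<open>y\<close> has a left inverse too, which must be
  \<open>x\<close>.\<close>

lemma Units_if_notin_jacobson_radical:
  assumes x: "x \<in> carrier R" "x \<notin> jacobson_radical R"
  shows "x \<in> Units R"
proof -
  have left_inv: "\<exists>y\<in>carrier R. y \<otimes> z = \<one>" if "z \<in> carrier R" "z \<notin> jacobson_radical R" for z
    using left_inverse_if_notin_maximal[of z] that maximal_left_ideal_eq_jacobson_radical by metis
  obtain y where y: "y \<in> carrier R" "y \<otimes> x = \<one>" using left_inv x by auto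
  have "y \<notin> jacobson_radical R"
  proof
    assume "y \<in> jacobson_radical R"
    then have "\<ominus> (x \<otimes> y) \<in> jacobson_radical R" using jacobson_radical_closed(4,5) x by blast
    then have v: "\<one> \<oplus> \<ominus> (x \<otimes> y) \<in> Units R" by (rule one_plus_jacobson_radical_Units)
    have "(\<one> \<oplus> \<ominus> (x \<otimes> y)) \<otimes> x = \<zero>"
      using x y by (simp add: l_distr l_minus m_assoc r_neg)
    then have "x = \<zero>"
      using Units_l_cancel[OF v x(1) zero_closed] v by (simp add: Units_closed)
    then show False using x(2) jacobson_radical_closed(2) by simp
  qed
  then obtain z where z: "z \<in> carrier R" "z \<otimes> y = \<one>" using left_inv y by auto
  have "z = x" using inv_unique[of z y x] x y z by auto
  then show ?thesis using UnitsI[of x y] x y z by auto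
qed

lemma nilpotents_subset_jacobson_radical: "nilpotents R \<subseteq> jacobson_radical R"
proof
  fix x assume x: "x \<in> nilpotents R"
  then have "x \<in> carrier R" by (rule nilpotentsE)
  then show "x \<in> jacobson_radical R"
    using Units_if_notin_jacobson_radical Units_not_nilpotent[OF one_not_zero] x by blast
qed

text \<open>An element outside the radical is a torsion unit plus zero. Conversely, nilpotents lie
  in the radical, so a torsion unit plus a nilpotent is a unit and avoids the radical.\<close>

lemma generalized_t_fine_ring_if_torsion:
  assumes tors: "Units R \<subseteq> torsion_units R"
  shows "generalized_t_fine_ring R"
proof (intro generalized_t_fine_ring.intro generalized_t_fine_ring_axioms.intro ring_axioms
    equalityI subsetI)
  fix x assume "x \<in> carrier R - jacobson_radical R"
  then have "x \<in> torsion_units R" "x \<in> carrier R"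
    using Units_if_notin_jacobson_radical tors by auto
  moreover have "\<zero> \<in> nilpotents R" by (auto simp: nilpotents_def intro!: exI[of _ 1])
  ultimately show "x \<in> torsion_units R <+> nilpotents R"
    using set_addI[of x _ \<zero>] by fastforce
next
  fix x assume "x \<in> torsion_units R <+>\<^bsub>R\<^esub> nilpotents R"
  then obtain t q where t: "t \<in> Units R" and q: "q \<in> jacobson_radical R" and x: "x = t \<oplus> q"
    using nilpotents_subset_jacobson_radical unfolding set_add_def' torsion_units_def by blast
  then have "x \<in> Units R" using Units_plus_jacobson_radical by simp
  then show "x \<in> carrier R - jacobson_radical R"
    using Units_notin_jacobson_radical[OF one_not_zero] Units_closed by blast
qed

end

section \<open>Generalized t-fine rings\<close>

context generalized_t_fine_ring
begin

lemma decompose: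
  assumes "x \<in> carrier R" "x \<notin> jacobson_radical R"
  obtains t q where "t \<in> torsion_units R" "q \<in> nilpotents R" "x = t \<oplus> q"
proof -
  have "x \<in> torsion_units R <+> nilpotents R" using assms t_fine by blast
  then show thesis using that by (auto simp: set_add_def')
qed

text \<open>The sum \<open>1 + 0\<close> of a torsion unit and a nilpotent lies outside the radical,
  whereas zero lies inside.\<close>

lemma one_not_zero: "\<one> \<noteq> \<zero>"
proof
  assume z: "\<one> = \<zero>"
  have "\<one> \<in> torsion_units R" "\<zero> \<in> nilpotents R"
    by (auto simp: torsion_units_def nilpotents_def intro!: exI[of _ 1])
  then have "\<one> \<oplus> \<zero> \<in> torsion_units R <+> nilpotents R" by (rule set_addI)
  then have "\<one> \<notin> jacobson_radical R" using t_fine by auto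
  then show False using z jacobson_radical_closed(2) by simp
qed

end

section \<open>Generalized t-fine rings that are NR\<close>

locale nr_generalized_t_fine_ring = nr_ring + generalized_t_fine_ring
begin

sublocale nilpotents: additive_subgroup "nilpotents R" R
  by (rule nilpotents_additive_subgroup)

lemma nilpotents_subset_jacobson_radical: "nilpotents R \<subseteq> jacobson_radical R"
proof
  fix x assume x: "x \<in> nilpotents R"
  show "x \<in> jacobson_radical R"
  proof (rule ccontr)
    assume "x \<notin> jacobson_radical R"
    then obtain t q where t: "t \<in> torsion_units R" and q: "q \<in> nilpotents R" and e: "x = t \<oplus> q"
      using decompose x nilpotents.a_subset by blast
    have c: "t \<in> Units R" "t \<in> carrier R" "q \<in> carrier R"
      using t q nilpotents.a_subset by (auto simp: torsion_units_def)
    \<comment> \<open>The NR property enters here: the difference of two nilpotents is nilpotent,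
      and this one equals the unit \<open>t\<close>.\<close>
    have "x \<oplus> \<ominus> q \<in> nilpotents R" using x q by auto
    then have "t \<in> nilpotents R" using e c by (simp add: a_assoc r_neg)
    then show False using Units_not_nilpotent[OF one_not_zero c(1)] by blast
  qed
qed

lemma Units_if_notin_jacobson_radical: "carrier R - jacobson_radical R \<subseteq> Units R"
proof
  fix x assume "x \<in> carrier R - jacobson_radical R"
  then obtain t q where t: "t \<in> torsion_units R" and q: "q \<in> nilpotents R" and e: "x = t \<oplus> q"
    using decompose by blast
  have "t \<in> Units R" using t by (simp add: torsion_units_def)
  then show "x \<in> Units R"
    unfolding e using Units_plus_jacobson_radical q nilpotents_subset_jacobson_radical by blast
qed

lemma positive_characteristic:
  obtains N :: nat where "N \<noteq> 0" "[N] \<cdot> \<one> = \<zero>"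
proof -
  \<comment> \<open>Two and three differ by one, so they cannot both lie in the radical.\<close>
  have "\<exists>a::nat. a \<ge> 2 \<and> [a] \<cdot> \<one> \<notin> jacobson_radical R"
  proof (rule ccontr)
    assume "\<not> ?thesis"
    then have j: "[(2::nat)] \<cdot> \<one> \<in> jacobson_radical R" "[(3::nat)] \<cdot> \<one> \<in> jacobson_radical R" by auto
    have "[(3::nat)] \<cdot> \<one> = \<one> \<oplus> ([(2::nat)] \<cdot> \<one>)"
      by (simp add: numeral_eq_Suc a_assoc)
    then have "([(3::nat)] \<cdot> \<one>) \<oplus> \<ominus> ([(2::nat)] \<cdot> \<one>) = \<one>" by (simp add: a_assoc r_neg)
    moreover have "([(3::nat)] \<cdot> \<one>) \<oplus> \<ominus> ([(2::nat)] \<cdot> \<one>) \<in> jacobson_radical R"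
      using j jacobson_radical_closed(3,4) by blast
    ultimately show False using one_notin_jacobson_radical[OF one_not_zero] by simp
  qed
  then obtain a :: nat where a: "a \<ge> 2" "[a] \<cdot> \<one> \<notin> jacobson_radical R" by auto
  then obtain t q where "t \<in> torsion_units R" "q \<in> nilpotents R" "[a] \<cdot> \<one> = t \<oplus> q"
    using decompose[of "[a] \<cdot> \<one>"] by auto
  then show thesis
    using positive_characteristic_if_torsion_plus_nilpotent a(1) that by blast
qed

text \<open>Decomposing the unit \<open>1 + j\<close> as \<open>t + q\<close> gives
  \<open>j = (t - 1) + q\<close>. The element \<open>t - 1 = j - q\<close> is in the radical and has
  finitely many powers because \<open>t\<close> has finite order, so it is nilpotent; the NR
  property then covers the sum.\<close>

lemma jacobson_radical_subset_nilpotents: "jacobson_radical R \<subseteq> nilpotents R"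
proof
  fix j assume j: "j \<in> jacobson_radical R"
  then have jc: "j \<in> carrier R" using jacobson_radical_closed(1) by auto
  have "\<one> \<oplus> j \<notin> jacobson_radical R"
    using one_plus_jacobson_radical_Units[OF j] Units_notin_jacobson_radical[OF one_not_zero] by auto
  then obtain t q where t: "t \<in> torsion_units R" and q: "q \<in> nilpotents R" and e: "\<one> \<oplus> j = t \<oplus> q"
    using decompose[of "\<one> \<oplus> j"] jc by auto
  obtain m :: nat where m: "m \<ge> 1" "t [^] m = \<one>" and tc: "t \<in> carrier R"
    using t by (auto simp: torsion_units_def)
  have qc: "q \<in> carrier R" using q nilpotents.a_subset by auto
  let ?s = "t \<oplus> \<ominus> \<one>"
  have "j = \<ominus> \<one> \<oplus> (\<one> \<oplus> j)" using jc by (simp add: a_assoc[symmetric] l_neg)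
  also have "\<dots> = ?s \<oplus> q" unfolding e using tc qc by (simp add: a_ac)
  finally have js: "j = ?s \<oplus> q" .
  then have "?s = j \<oplus> \<ominus> q" using tc qc by (simp add: a_assoc r_neg)
  then have "?s \<in> jacobson_radical R"
    using j q nilpotents_subset_jacobson_radical jacobson_radical_closed(3,4) by auto
  moreover obtain N :: nat where "N \<noteq> 0" "[N] \<cdot> \<one> = \<zero>" using positive_characteristic .
  then have "finite (range (\<lambda>n::nat. ?s [^] n))"
    using finite_range_pow_plus finite_range_pow_if_pow_eq_one tc m by metis
  ultimately have "?s \<in> nilpotents R" by (rule jacobson_radical_nilpotent_if_finite_range_pow)
  then show "j \<in> nilpotents R" using js q by auto
qed

text \<open>Modulo the radical \<open>u\<close> agrees with the torsion unit \<open>t\<close>, so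
  \<open>u^m = 1 + j\<close> when \<open>t^m = 1\<close>. As \<open>j\<close> is nilpotent,
  \<open>1 + j\<close> has finitely many powers, and a unit with finitely many powers is
  torsion.\<close>

lemma Units_subset_torsion_units: "Units R \<subseteq> torsion_units R"
proof
  fix u assume u: "u \<in> Units R"
  then obtain t q where t: "t \<in> torsion_units R" and q: "q \<in> nilpotents R" and e: "u = t \<oplus> q"
    using decompose Units_notin_jacobson_radical[OF one_not_zero] by blast
  obtain m :: nat where m: "m \<ge> 1" "t [^] m = \<one>" and tc: "t \<in> carrier R"
    using t by (auto simp: torsion_units_def)
  have qJ: "q \<in> jacobson_radical R" using q nilpotents_subset_jacobson_radical by auto
  have qc: "q \<in> carrier R" using q nilpotents.a_subset by auto
  \<comment> \<open>The congruence of powers needs a two-sided ideal: the error term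
    \<open>j (t + q)\<close> has the radical element on the left.\<close>
  note right = jacobson_radical_right_closed[OF one_not_zero Units_if_notin_jacobson_radical]
  have "\<exists>j\<in>jacobson_radical R. u [^] n = t [^] n \<oplus> j" for n :: nat
  proof (induction n)
    case 0
    then show ?case using jacobson_radical_closed(2) by (intro bexI[of _ \<zero>]) auto
  next
    case (Suc n)
    then obtain j where j: "j \<in> jacobson_radical R" "u [^] n = t [^] n \<oplus> j" by auto
    have jc: "j \<in> carrier R" using j jacobson_radical_closed(1) by auto
    have "t [^] n \<otimes> q \<oplus> j \<otimes> (t \<oplus> q) \<in> jacobson_radical R"
      using jacobson_radical_closed(3,5) right j(1) qJ tc qc by auto
    moreover have "u [^] Suc n = t [^] Suc n \<oplus> (t [^] n \<otimes> q \<oplus> j \<otimes> (t \<oplus> q))"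
      using j(2) e tc qc jc by (simp add: l_distr r_distr a_ac)
    ultimately show ?case by blast
  qed
  then obtain j where j: "j \<in> jacobson_radical R" "u [^] m = \<one> \<oplus> j" using m(2) by metis
  then have jN: "j \<in> nilpotents R" using jacobson_radical_subset_nilpotents by auto
  have jc: "j \<in> carrier R" using j jacobson_radical_closed(1) by auto
  obtain N :: nat where "N \<noteq> 0" "[N] \<cdot> \<one> = \<zero>" using positive_characteristic .
  then have "finite (range (\<lambda>n::nat. (j \<oplus> \<one>) [^] n))"
    using finite_range_pow_plus finite_range_pow_if_nilpotent jN jc by metis
  then have "u [^] m \<in> torsion_units R"
    using Units_torsion_if_finite_range_pow[OF Units_pow[OF u, of m]] j(2) jc
    by (simp add: a_comm)
  then obtain k :: nat where "k \<ge> 1" "(u [^] m) [^] k = \<one>" by (auto simp: torsion_units_def)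
  then show "u \<in> torsion_units R"
    using u m(1) by (auto simp: torsion_units_def nat_pow_pow Units_closed intro!: exI[of _ "m * k"])
qed

lemma nil_ideal_jacobson_radical: "nil_ideal (jacobson_radical R) R"
proof (intro nil_ideal.intro nil_ideal_axioms.intro jacobson_radical_subset_nilpotents)
  show "ideal (jacobson_radical R) R"
    using jacobson_radical_closed
      jacobson_radical_right_closed[OF one_not_zero Units_if_notin_jacobson_radical]
    by (intro idealI ring_axioms add.subgroupI) auto
qed

end

section \<open>The unit group and the equivalence\<close>

lemma (in ring) torsion_group_units_of_iff:
  "torsion_group (units_of R) \<longleftrightarrow> Units R \<subseteq> torsion_units R"
proof -
  \<comment> \<open>Finite order refers to powers in the group \<open>units_of R\<close>, torsion
    units to powers in the ring; the two have to be identified first.\<close>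
  have pow: "x [^]\<^bsub>units_of R\<^esub> (n::nat) = x [^] n" for x n
    by (induction n) (simp_all add: units_of_mult units_of_one)
  show ?thesis
    using units_group
    by (auto simp: torsion_group_def torsion_group_axioms_def torsion_units_def
        units_of_carrier units_of_one pow)
qed

theorem theorem2p8:
  fixes R :: "('a, 'b) ring_scheme"
  assumes "nr_ring R"
  shows "(generalized_t_fine_ring R \<longleftrightarrow> local_ring R \<and> torsion_group (units_of R))
    \<and> (generalized_t_fine_ring R \<longrightarrow> nil_ideal (jacobson_radical R) R)"
proof -
  interpret nr_ring R by fact
  have *: "local_ring R \<and> torsion_group (units_of R) \<and> nil_ideal (jacobson_radical R) R"
    if "generalized_t_fine_ring R"
  proof -
    interpret nr_generalized_t_fine_ring R
      using assms that by (rule nr_generalized_t_fine_ring.intro)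
    show ?thesis
      using local_ring_if_Units[OF one_not_zero Units_if_notin_jacobson_radical]
        torsion_group_units_of_iff Units_subset_torsion_units nil_ideal_jacobson_radical by auto
  qed
  then show ?thesis
    using local_ring.generalized_t_fine_ring_if_torsion torsion_group_units_of_iff by auto
qed

end
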